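(* If $f\in\mathcal{S}^*_e$, then $f\in\Omega$ in the disc $|z|<r_0$, i.e. $|zf'(z)-f(z)|<\frac12$ for all $|z|<r_0$, where $r_0\approx0.476813$ is the smallest positive root of $2(e^r-1)f_0(r)-1=0$ and $$f_0(z)=z\exp\left(\int_0^z\frac{e^t-1}{t}\,dt\right)=z+z^2+\frac{3z^3}{4}+\frac{17z^4}{36}+\frac{19z^5}{72}+\cdots.$$ Moreover, this estimate is sharp, i.e. $r_0$ cannot be replaced by a larger number.
   Context: $\mathbb{D}=\{z\in\mathbb{C}:|z|<1\}$. $\mathcal{A}$ is the class of analytic functions $f$ on $\mathbb{D}$ with $f(0)=0$, $f'(0)=1$. $\Omega=\{f\in\mathcal{A}:|zf'(z)-f(z)|<\frac12,\ z\in\mathbb{D}\}$; "$f\in\Omega$ in the disc $|z|<r_0$" means that the defining inequality holds for all $|z|<r_0$. $\mathcal{S}^*_e$ is the class of $f\in\mathcal{A}$ with $zf'(z)/f(z)\prec e^z$, where $p\prec\phi$ means $p=\phi\circ\omega$ for some analytic $\omega:\mathbb{D}\to\mathbb{D}$ with $\omega(0)=0$. *)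

theory Defs
  imports "HOL-Complex_Analysis.Complex_Analysis"
begin

abbreviation unit_disc :: "complex set" (\<open>\<D>\<close>) where
  "\<D> \<equiv> ball 0 1"

text \<open>Functions on the unit disc are represented by total functions; only their values on the disc
  are ever used.\<close>

definition class_A :: "(complex \<Rightarrow> complex) set" where
  "class_A = {f. f holomorphic_on \<D> \<and> f 0 = 0 \<and> deriv f 0 = 1}"

definition subordinate :: "(complex \<Rightarrow> complex) \<Rightarrow> (complex \<Rightarrow> complex) \<Rightarrow> bool" (infix \<open>\<prec>\<^sub>s\<close> 50) where
  "p \<prec>\<^sub>s \<phi> \<longleftrightarrow>
     (\<exists>\<omega>. \<omega> holomorphic_on \<D> \<and> \<omega> ` \<D> \<subseteq> \<D> \<and> \<omega> 0 = 0 \<and> (\<forall>z\<in>\<D>. p z = \<phi> (\<omega> z)))"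

text \<open>The quotient $z f'(z)/f(z)$ of a function in \<open>class_A\<close> has a removable singularity at $0$,
  where its value is $1$.  At a zero of $f$ other than $0$ it has a pole, but evaluates to $0$ here
  by the convention on division by zero; as $0$ is not a value of the exponential function, a
  function $f$ with such a zero is not in \<open>starlike_exp\<close>.\<close>

definition log_quotient :: "(complex \<Rightarrow> complex) \<Rightarrow> complex \<Rightarrow> complex" where
  "log_quotient f z = (if z = 0 then 1 else z * deriv f z / f z)"

definition starlike_exp :: "(complex \<Rightarrow> complex) set" where
  "starlike_exp = {f \<in> class_A. log_quotient f \<prec>\<^sub>s exp}"

text \<open>The functions that are in $\Omega$ in the disc $|z|<r$; the class $\Omega$ itself is
  the case $r=1$.\<close>

definition Omega_in_disc :: "real \<Rightarrow> (complex \<Rightarrow> complex) set" where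
  "Omega_in_disc r = {f \<in> class_A. \<forall>z. norm z < r \<longrightarrow> norm (z * deriv f z - f z) < 1 / 2}"

text \<open>The integrand is extended by $0$ at $t=0$ (division by zero), which does not affect the
  integral.\<close>

definition f0 :: "complex \<Rightarrow> complex" where
  "f0 z = z * exp (contour_integral (linepath 0 z) (\<lambda>t. (exp t - 1) / t))"

definition smallest_positive_root :: "(real \<Rightarrow> complex) \<Rightarrow> real \<Rightarrow> bool" where
  "smallest_positive_root g r \<longleftrightarrow> 0 < r \<and> g r = 0 \<and> (\<forall>s. 0 < s \<and> g s = 0 \<longrightarrow> r \<le> s)"

end

theory Submission
  imports Defs
begin

text \<open>Write \<open>z f' z / f z = e\<^bsup>\<omega> z\<^esup>\<close>.  By Schwarz' lemma \<open>\<bar>\<omega> z\<bar> \<le> \<bar>z\<bar>\<close>, hence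
  \<open>\<bar>e\<^bsup>\<omega> z\<^esup> - 1\<bar> \<le> e\<^bsup>\<bar>z\<bar>\<^esup> - 1\<close>, and integrating \<open>(e\<^bsup>\<omega> z\<^esup> - 1) / z\<close>, the logarithmic derivative of
  \<open>f z / z\<close>, along a radius gives \<open>\<bar>f z\<bar> \<le> f\<^sub>0 \<bar>z\<bar>\<close>.  So
  \<open>\<bar>z f' z - f z\<bar> \<le> (e\<^bsup>\<bar>z\<bar>\<^esup> - 1) f\<^sub>0 \<bar>z\<bar>\<close>, with equality for \<open>f = f\<^sub>0\<close> (\<open>\<omega> z = z\<close>) at real \<open>z \<ge> 0\<close>.\<close>

section \<open>Taylor enclosures with a geometric remainder, and the exponential estimate\<close>

lemma suminf_geometric_tail:
  fixes c :: "nat \<Rightarrow> real"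
  assumes nonneg: "\<And>k. 0 \<le> c k" and half: "\<And>k. n \<le> k \<Longrightarrow> 2 * c (Suc k) \<le> c k"
  shows "(\<Sum>k<n. c k) \<le> suminf c" "suminf c \<le> (\<Sum>k<n. c k) + 2 * c n"
proof -
  \<comment> \<open>Halving from index \<open>n\<close> on puts the tail below a geometric series
    with first term \<open>c n\<close> and sum \<open>2 * c n\<close>.\<close>
  have tail: "c (k + n) \<le> c n * (1 / 2) ^ k" for k
  proof (induction k)
    case (Suc k)
    then show ?case using half[of "k + n"] by simp
  qed simp
  have geo: "(\<lambda>k. c n * (1 / 2) ^ k) sums (c n * 2)"
    using sums_mult[OF geometric_sums[of "1 / 2 :: real"], of "c n"] by simp
  have "summable (\<lambda>k. c (k + n))"
    by (rule summable_comparison_test'[OF sums_summable[OF geo], of 0]) (use tail nonneg in auto)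
  then have sm: "summable c" by (simp add: summable_iff_shift)
  show "(\<Sum>k<n. c k) \<le> suminf c" by (rule sum_le_suminf[OF sm]) (use nonneg in auto)
  have "(\<Sum>k. c (k + n)) \<le> c n * 2"
    using suminf_le[OF tail \<open>summable (\<lambda>k. c (k + n))\<close> sums_summable[OF geo]] sums_unique[OF geo]
    by simp
  then show "suminf c \<le> (\<Sum>k<n. c k) + 2 * c n"
    using suminf_split_initial_segment[OF sm, of n] by simp
qed

text \<open>From index 1 on, consecutive terms have ratio \<open>x / (k + 1)\<close>, at most 1/2.
  This serves to enclose \<open>exp\<close> at explicit rationals.\<close>

lemma exp_Taylor_bounds:
  fixes x :: real
  assumes "0 \<le> x" "x \<le> 1" "0 < n"
  shows "(\<Sum>k<n. x ^ k / fact k) \<le> exp x" "exp x \<le> (\<Sum>k<n. x ^ k / fact k) + 2 * (x ^ n / fact n)"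
proof -
  have half: "2 * (x ^ Suc k / fact (Suc k)) \<le> x ^ k / fact k" if "n \<le> k" for k
  proof -
    have "2 * x \<le> real (Suc k)" using assms that by simp
    then have "2 * x * x ^ k \<le> real (Suc k) * x ^ k" using assms by (intro mult_right_mono) auto
    then have "2 * x * x ^ k / (real (Suc k) * fact k) \<le> x ^ k / fact k"
      by (simp add: divide_le_eq mult.commute del: of_nat_Suc)
    then show ?thesis by (simp add: mult.assoc)
  qed
  have "exp x = (\<Sum>k. x ^ k / fact k)" by (simp add: exp_def field_simps)
  then show "(\<Sum>k<n. x ^ k / fact k) \<le> exp x"
    "exp x \<le> (\<Sum>k<n. x ^ k / fact k) + 2 * (x ^ n / fact n)"
    using suminf_geometric_tail[of "\<lambda>k. x ^ k / fact k" n] half assms by auto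
qed

text \<open>Subtracting 1 removes the constant term of the series, so taking norms termwise gives
  the same series at \<open>norm z\<close>.\<close>

lemma norm_exp_minus_one_le: "norm (exp z - 1) \<le> exp (norm z) - 1"
  for z :: "'a::{real_normed_algebra_1,banach}"
proof -
  have nrm: "norm (inverse (fact (Suc n)) *\<^sub>R z ^ Suc n) \<le> inverse (fact (Suc n)) *\<^sub>R norm z ^ Suc n"
    for n
    using norm_power_ineq[of z "Suc n"] by (simp add: mult_left_mono del: power_Suc fact_Suc)
  have sm: "summable (\<lambda>n. inverse (fact (Suc n)) *\<^sub>R norm z ^ Suc n)"
    using summable_exp_generic[of "norm z"] by (subst summable_Suc_iff)
  have "norm (exp z - 1) = norm (\<Sum>n. inverse (fact (Suc n)) *\<^sub>R z ^ Suc n)"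
    by (simp add: exp_first_term[of z] del: power_Suc fact_Suc)
  also have "\<dots> \<le> (\<Sum>n. inverse (fact (Suc n)) *\<^sub>R norm z ^ Suc n)"
    using nrm sm by (rule norm_suminf_le)
  also have "\<dots> = exp (norm z) - 1"
    by (simp add: exp_first_term[of "norm z"] del: power_Suc fact_Suc)
  finally show ?thesis .
qed

section \<open>The primitive of (e^t - 1)/t as a power series\<close>

text \<open>The power series of $\int_0^x (e^t-1)/t\,dt$; its term at \<open>n = 0\<close> vanishes by \<open>1 / 0 = 0\<close>.\<close>

definition exp_int :: "'a::{real_normed_field,banach} \<Rightarrow> 'a" where
  "exp_int x = (\<Sum>n. 1 / (of_nat n * fact n) * x ^ n)"

lemma summable_exp_int: "summable (\<lambda>n. 1 / (of_nat n * fact n) * x ^ n)"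
  for x :: "'a::{real_normed_field,banach}"
proof (rule summable_comparison_test'[OF summable_exp_generic[of "norm x"], of 1])
  fix n :: nat assume "1 \<le> n"
  then have "fact n * norm x ^ n \<le> real n * fact n * norm x ^ n"
    by (intro mult_right_mono) auto
  then show "norm (1 / (of_nat n * fact n) * x ^ n) \<le> inverse (fact n) *\<^sub>R norm x ^ n"
    using \<open>1 \<le> n\<close> by (simp add: norm_mult norm_divide norm_power field_simps)
qed

lemma exp_int_0 [simp]: "exp_int 0 = 0"
  using powser_zero[of "\<lambda>n. 1 / (of_nat n * fact n) :: 'a::{real_normed_field,banach}"]
  by (simp add: exp_int_def)

lemma exp_int_of_real:
  "exp_int (of_real x :: 'a::{real_normed_field,banach}) = of_real (exp_int x)"
  unfolding exp_int_def by (subst suminf_of_real[OF summable_exp_int]) (simp add: of_real_power)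

text \<open>Termwise differentiation cancels the factor \<open>n\<close> and leaves the series of
  (e^x - 1)/x, with constant term 1. The general field covers both \<open>f0\<close> on the complex
  plane and the radial comparison on the reals.\<close>

lemma has_field_derivative_exp_int:
  fixes x :: "'a::{real_normed_field,banach}"
  shows "(exp_int has_field_derivative (if x = 0 then 1 else (exp x - 1) / x)) (at x)"
proof -
  define c where "c n = (1 / (of_nat n * fact n) :: 'a)" for n
  have d: "diffs c n = inverse (fact (Suc n))" for n
    by (simp add: diffs_def c_def field_simps del: of_nat_Suc)
  have "(\<Sum>n. diffs c n * x ^ n) = (if x = 0 then 1 else (exp x - 1) / x)"
  proof (cases "x = 0")
    case True
    then show ?thesis using powser_zero[of "diffs c"] by (simp add: d)
  next
    case False
    have sm: "summable (\<lambda>n. diffs c n * x ^ n)"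
      by (rule termdiff_converges_all) (use summable_exp_int in \<open>simp add: c_def\<close>)
    have "exp x = 1 + (\<Sum>n. x * (diffs c n * x ^ n))"
      unfolding exp_first_term[of x]
      by (intro arg_cong[where f = "\<lambda>t. 1 + t"] suminf_cong)
        (simp add: d scaleR_conv_of_real algebra_simps del: fact_Suc of_nat_Suc)
    then show ?thesis using False suminf_mult[OF sm, of x] by simp
  qed
  moreover have "summable (\<lambda>n. c n * y ^ n)" for y
    unfolding c_def by (rule summable_exp_int)
  ultimately show ?thesis
    using termdiffs_strong_converges_everywhere[of c x] by (simp only: exp_int_def[abs_def] c_def)
qed

text \<open>The ratio of consecutive terms is \<open>x * k / (k + 1)^2\<close>, and
  \<open>2 * k\<close> is at most \<open>(k + 1)^2\<close>. Here \<open>0 < n\<close> matters: the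
  term at 0 is 0 by division by zero, so halving fails there when \<open>x > 0\<close>.\<close>

lemma exp_int_Taylor_bounds:
  fixes x :: real
  assumes "0 \<le> x" "x \<le> 1" "0 < n"
  shows "(\<Sum>k<n. x ^ k / (real k * fact k)) \<le> exp_int x"
    "exp_int x \<le> (\<Sum>k<n. x ^ k / (real k * fact k)) + 2 * (x ^ n / (real n * fact n))"
proof -
  have half: "2 * (x ^ Suc k / (real (Suc k) * fact (Suc k))) \<le> x ^ k / (real k * fact k)" if "n \<le> k" for k
  proof -
    have "x * (2 * real k) \<le> 1 * (real (Suc k) * real (Suc k))"
      using assms that by (intro mult_mono) (auto simp: algebra_simps)
    then have "x * (2 * real k) * x ^ k \<le> real (Suc k) * real (Suc k) * x ^ k"
      using assms by (intro mult_right_mono) auto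
    then have "x * (2 * real k) * x ^ k / (real (Suc k) * real (Suc k) * (real k * fact k))
        \<le> x ^ k / (real k * fact k)"
      using assms that by (simp add: divide_le_eq le_divide_eq mult_ac del: of_nat_Suc)
    then show ?thesis using assms that by (simp add: mult_ac del: of_nat_Suc)
  qed
  have "exp_int x = (\<Sum>k. x ^ k / (real k * fact k))" by (simp add: exp_int_def)
  then show "(\<Sum>k<n. x ^ k / (real k * fact k)) \<le> exp_int x"
    "exp_int x \<le> (\<Sum>k<n. x ^ k / (real k * fact k)) + 2 * (x ^ n / (real n * fact n))"
    using suminf_geometric_tail[of "\<lambda>k. x ^ k / (real k * fact k)" n] half assms by auto
qed

lemma exp_int_mono:
  fixes x y :: real
  assumes "0 \<le> x" "x \<le> y"
  shows "exp_int x \<le> exp_int y"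
proof (rule DERIV_nonneg_imp_nondecreasing[OF assms(2)])
  fix t assume "x \<le> t" "t \<le> y"
  then have "(if t = 0 then 1 else (exp t - 1) / t) \<ge> 0" using assms by simp
  then show "\<exists>D. DERIV exp_int t :> D \<and> 0 \<le> D" using has_field_derivative_exp_int by blast
qed

section \<open>The extremal function \<open>f0\<close>\<close>

lemma f0_eq: "f0 z = z * exp (exp_int z)"
proof (cases "z = 0")
  case False
  \<comment> \<open>The integrand takes the value 0 at \<open>t = 0\<close>, its continuous
    extension the value 1; one point does not change the integral, and the extension has the
    primitive \<open>exp_int\<close>.\<close>
  have "contour_integral (linepath 0 z) (\<lambda>t. (exp t - 1) / t) =
      contour_integral (linepath 0 z) (\<lambda>t. if t = 0 then 1 else (exp t - 1) / t)"
    by (rule contour_integral_spike_finite_simple_path[of "{0}"]) (use False in auto)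
  also have "\<dots> = exp_int z - exp_int 0"
    using contour_integral_primitive[of UNIV exp_int
        "\<lambda>t. if t = 0 then 1 else (exp t - 1) / t" "linepath 0 z"]
      has_field_derivative_exp_int[where ?'a = complex]
    by (intro contour_integral_unique) auto
  finally show ?thesis by (simp add: f0_def)
qed (simp add: f0_def)

lemma f0_of_real: "f0 (of_real r) = of_real (r * exp (exp_int r))"
  by (simp add: f0_eq exp_int_of_real exp_of_real)

lemma has_field_derivative_exp_exp_int:
  fixes z :: complex
  shows "((\<lambda>z. exp (exp_int z)) has_field_derivative
    exp (exp_int z) * (if z = 0 then 1 else (exp z - 1) / z)) (at z)"
  by (rule DERIV_chain2[OF DERIV_exp has_field_derivative_exp_int])

text \<open>The product rule yields \<open>exp (exp_int z)\<close> times 1 + (e^z - 1).\<close>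

lemma has_field_derivative_f0: "(f0 has_field_derivative exp z * exp (exp_int z)) (at z)"
proof -
  have "((\<lambda>z. z * exp (exp_int z)) has_field_derivative exp z * exp (exp_int z)) (at z)"
    by (rule DERIV_cong[OF DERIV_mult[OF DERIV_ident has_field_derivative_exp_exp_int]])
      (auto simp: field_simps)
  then show ?thesis by (simp add: f0_eq[abs_def])
qed

lemma f0_holomorphic: "f0 holomorphic_on A"
  by (rule holomorphic_onI) (meson has_field_derivative_f0 field_differentiable_at_within
      field_differentiable_def)

lemma deriv_f0: "deriv f0 z = exp z * exp (exp_int z)"
  by (rule DERIV_imp_deriv[OF has_field_derivative_f0])

text \<open>Comparing coefficients in \<open>z g' = (e\<^sup>z - 1) g\<close> for \<open>g = f\<^sub>0 / z\<close> yields
  \<open>n g\<^sub>n = (\<Sum>k=1..n. g\<^sub>n\<^sub>-\<^sub>k / k!)\<close>.\<close>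

lemma f0_power_series:
  "\<exists>a :: nat \<Rightarrow> complex. (\<forall>z\<in>\<D>. (\<lambda>n. a n * z ^ n) sums f0 z) \<and>
     a 0 = 0 \<and> a 1 = 1 \<and> a 2 = 1 \<and> a 3 = 3 / 4 \<and> a 4 = 17 / 36 \<and> a 5 = 19 / 72"
proof -
  define g :: "complex \<Rightarrow> complex" where "g = (\<lambda>z. exp (exp_int z))"
  define G where "G = fps_expansion g 0"
  have "g holomorphic_on UNIV"
    unfolding g_def holomorphic_on_def field_differentiable_def
    using has_field_derivative_exp_exp_int by blast
  then have G: "g has_fps_expansion G"
    unfolding G_def by (intro has_fps_expansion_fps_expansion[of UNIV]) auto
  have G0: "fps_nth G 0 = 1"
    using fps_nth_fps_expansion[OF G, of 0] by (simp add: g_def)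
  have dg: "z * deriv g z = (exp z - 1) * g z" for z
    using DERIV_imp_deriv[OF has_field_derivative_exp_exp_int, of z] by (simp add: g_def)
  \<comment> \<open>Expanding both sides of the differential equation turns it into an identity of
    formal power series.\<close>
  have "(\<lambda>z. z * deriv g z) has_fps_expansion fps_X * fps_deriv G"
    by (intro fps_expansion_intros G)
  moreover have "(\<lambda>z. z * deriv g z) has_fps_expansion (fps_exp 1 - 1) * G"
    unfolding dg by (intro fps_expansion_intros G)
  ultimately have eq: "fps_X * fps_deriv G = (fps_exp 1 - 1) * G"
    by (rule fps_expansion_unique_complex)
  have rec: "fps_nth G (Suc n) = (\<Sum>k=0..n. fps_nth G (n - k) / fact (Suc k)) / of_nat (Suc n)" for n
  proof -
    have "of_nat (Suc n) * fps_nth G (Suc n) = fps_nth ((fps_exp 1 - 1) * G) (Suc n)"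
      by (subst eq[symmetric]) simp
    also have "\<dots> = (\<Sum>k=0..Suc n. fps_nth (fps_exp 1 - 1) k * fps_nth G (Suc n - k))"
      by (rule fps_mult_nth)
    \<comment> \<open>The constant coefficient of e^z - 1 is 0, so the convolution starts at index 1
      and is shifted down by one.\<close>
    also have "\<dots> = (\<Sum>k=0..n. fps_nth G (n - k) / fact (Suc k))"
      by (subst sum.atLeast0_atMost_Suc_shift) simp
    finally show ?thesis by (simp add: eq_divide_eq mult.commute del: of_nat_Suc)
  qed
  have G1: "fps_nth G (Suc 0) = 1" using rec[of 0] G0 by simp
  have "fps_nth G 2 = (fps_nth G 1 + fps_nth G 0 / 2) / 2"
    using rec[of 1] by (simp add: eval_nat_numeral)
  then have G2: "fps_nth G 2 = 3 / 4" by (simp add: G0 G1)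
  have "fps_nth G 3 = (fps_nth G 2 + fps_nth G 1 / 2 + fps_nth G 0 / 6) / 3"
    using rec[of 2] by (simp add: eval_nat_numeral)
  then have G3: "fps_nth G 3 = 17 / 36" by (simp add: G0 G1 G2)
  have "fps_nth G 4 = (fps_nth G 3 + fps_nth G 2 / 2 + fps_nth G 1 / 6 + fps_nth G 0 / 24) / 4"
    using rec[of 3] by (simp add: eval_nat_numeral)
  then have G4: "fps_nth G 4 = 19 / 72" by (simp add: G0 G1 G2 G3)
  \<comment> \<open>Multiplication by z shifts the coefficients: entry \<open>n + 1\<close> of
    \<open>F\<close> is entry \<open>n\<close> of \<open>G\<close>.\<close>
  define F where "F = fps_X * G"
  have "(\<lambda>z. z * g z) has_fps_expansion F"
    unfolding F_def by (intro fps_expansion_intros G)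
  then have F: "f0 has_fps_expansion F" by (simp add: g_def f0_eq[abs_def])
  have nth: "fps_nth F 0 = 0" "fps_nth F (Suc n) = fps_nth G n" for n by (simp_all add: F_def)
  have "(\<lambda>n. fps_nth F n * z ^ n) sums f0 z" if "z \<in> \<D>" for z
    using holomorphic_power_series[OF f0_holomorphic that] fps_nth_fps_expansion[OF F] by simp
  moreover have "fps_nth F 1 = 1" using nth(2)[of 0] G0 by simp
  moreover have "fps_nth F 2 = 1" using nth(2)[of 1] G1 by (simp add: numeral_2_eq_2)
  moreover have "fps_nth F 3 = 3 / 4" using nth(2)[of 2] G2 by (simp add: eval_nat_numeral)
  moreover have "fps_nth F 4 = 17 / 36" using nth(2)[of 3] G3 by (simp add: eval_nat_numeral)
  moreover have "fps_nth F 5 = 19 / 72" using nth(2)[of 4] G4 by (simp add: eval_nat_numeral)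
  ultimately show ?thesis using nth(1) by blast
qed

lemma f0_in_starlike_exp: "f0 \<in> starlike_exp"
proof -
  have "f0 \<in> class_A"
    by (simp add: class_A_def f0_holomorphic deriv_f0 f0_eq[of 0])
  moreover have "log_quotient f0 \<prec>\<^sub>s exp"
    unfolding subordinate_def
    by (intro exI[of _ "\<lambda>z. z"]) (auto simp: log_quotient_def deriv_f0 f0_eq)
  ultimately show ?thesis by (simp add: starlike_exp_def)
qed

section \<open>Growth estimates for functions subordinate to the exponential\<close>

lemma starlike_exp_growth:
  assumes f: "f \<in> starlike_exp" and z: "norm z < 1"
  shows "norm (f z) \<le> norm z * exp (exp_int (norm z))"
    and "norm (z * deriv f z - f z) \<le> norm (f z) * (exp (norm z) - 1)"
proof -
  have hol: "f holomorphic_on \<D>" and f_0: "f 0 = 0" and df_0: "deriv f 0 = 1"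
    using f by (auto simp: starlike_exp_def class_A_def)
  obtain \<omega> where \<omega>: "\<omega> holomorphic_on \<D>" "\<omega> ` \<D> \<subseteq> \<D>" "\<omega> 0 = 0"
      and lq: "\<And>w. w \<in> \<D> \<Longrightarrow> log_quotient f w = exp (\<omega> w)"
    using f by (auto simp: starlike_exp_def subordinate_def)
  have "norm (\<omega> w) < 1" if "norm w < 1" for w
    using \<omega>(2) that by (auto simp: image_subset_iff)
  then have "norm (\<omega> w) \<le> norm w" if "norm w < 1" for w
    using Schwarz_Lemma(1)[OF \<omega>(1,3)] that by blast
  then have exp_\<omega>: "norm (exp (\<omega> w) - 1) \<le> exp (norm w) - 1" if "norm w < 1" for w
    using norm_exp_minus_one_le[of "\<omega> w"] that by (meson diff_right_mono exp_le_cancel_iff order_trans)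
  have quot: "w * deriv f w / f w = exp (\<omega> w)" if "norm w < 1" "w \<noteq> 0" for w
    using lq[of w] that by (simp add: log_quotient_def)
  \<comment> \<open>At such a zero the quotient would be 0 by division by zero, but
    \<open>exp\<close> never vanishes.\<close>
  then have f_nz: "f w \<noteq> 0" if "norm w < 1" "w \<noteq> 0" for w
    using that by (metis div_by_0 exp_not_eq_zero)
  have zdf: "w * deriv f w = f w * exp (\<omega> w)" if "norm w < 1" "w \<noteq> 0" for w
    using quot[OF that] f_nz[OF that] by (simp add: field_simps)
  show "norm (z * deriv f z - f z) \<le> norm (f z) * (exp (norm z) - 1)"
  proof (cases "z = 0")
    case False
    then have "z * deriv f z - f z = f z * (exp (\<omega> z) - 1)"
      using zdf z by (simp add: algebra_simps)
    then show ?thesis using exp_\<omega>[OF z] by (simp add: norm_mult mult_left_mono)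
  qed (simp add: f_0)
  \<comment> \<open>This is f(w)/w with the singularity at 0 removed. It has no zeros on the disc,
    hence a holomorphic logarithm \<open>L\<close>.\<close>
  define g where "g = (\<lambda>w. if w = 0 then deriv f 0 else (f w - f 0) / (w - 0))"
  have "g holomorphic_on \<D>" unfolding g_def by (rule pole_lemma_open[OF hol]) simp
  moreover have "g w \<noteq> 0" if "w \<in> \<D>" for w
    using that f_nz by (auto simp: g_def df_0 f_0)
  moreover have "contractible \<D>" by (simp add: convex_imp_contractible)
  ultimately obtain L where L: "L holomorphic_on \<D>" and gL: "\<And>w. w \<in> \<D> \<Longrightarrow> g w = exp (L w)"
    using contractible_imp_holomorphic_log by metis
  have fL: "f w = w * exp (L w)" if "w \<in> \<D>" for w
    using gL[OF that] by (auto simp: g_def f_0 field_simps split: if_splits)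
  \<comment> \<open>\<open>L 0\<close> is fixed only up to multiples of 2 pi i, but its real part is
    all that the modulus of \<open>f\<close> needs.\<close>
  have "norm (exp (L 0)) = 1" using gL[of 0] by (simp add: g_def df_0 flip: gL)
  then have L_0: "Re (L 0) = 0" by simp
  have dL: "(L has_field_derivative deriv L w) (at w)" if "norm w < 1" for w
    using holomorphic_derivI[OF L, of w] that by simp
  \<comment> \<open>Differentiate f(w) = w e^(L w), substitute into \<open>zdf\<close> and cancel
    the nonzero factor f(w).\<close>
  have wdL: "w * deriv L w = exp (\<omega> w) - 1" if "norm w < 1" "w \<noteq> 0" for w
  proof -
    have "((\<lambda>w. w * exp (L w)) has_field_derivative exp (L w) + w * (exp (L w) * deriv L w)) (at w)"
      by (rule derivative_eq_intros dL that refl)+ (simp add: algebra_simps)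
    then have "(f has_field_derivative exp (L w) + w * (exp (L w) * deriv L w)) (at w)"
      by (rule has_field_derivative_transform_within_open[where S = \<D>]) (use that fL in auto)
    then have "w * (exp (L w) + w * (exp (L w) * deriv L w)) = w * exp (L w) * exp (\<omega> w)"
      using zdf[OF that] fL[of w] that by (simp add: DERIV_imp_deriv)
    then have "(w * exp (L w)) * (1 + w * deriv L w) = (w * exp (L w)) * exp (\<omega> w)"
      by (simp add: algebra_simps)
    then have "1 + w * deriv L w = exp (\<omega> w)" using that by (subst (asm) mult_cancel_left) simp
    then show ?thesis by (simp add: algebra_simps)
  qed
  show "norm (f z) \<le> norm z * exp (exp_int (norm z))"
  proof (cases "z = 0")
    case False
    define u where "u = z / of_real (norm z)"
    have nu: "norm u = 1" and zu: "of_real (norm z) * u = z"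
      using False by (simp_all add: u_def norm_divide)
    \<comment> \<open>Along the radius in direction \<open>u\<close>, \<open>\<phi>\<close> is log
      |f(w)/w| minus its claimed bound; it vanishes at 0, so it suffices that it does not
      increase.\<close>
    define \<phi> where "\<phi> = (\<lambda>t. Re (L (of_real t * u)) - exp_int t)"
    have d: "(\<phi> has_real_derivative
        Re (u * deriv L (of_real t * u)) - (if t = 0 then 1 else (exp t - 1) / t)) (at t)"
      if "0 \<le> t" "t < 1" for t
    proof -
      have "((\<lambda>t. of_real t * u) has_vector_derivative u) (at t)"
        by (auto intro!: derivative_eq_intros)
      moreover have "(L has_field_derivative deriv L (of_real t * u)) (at (of_real t * u))"
        by (rule dL) (use that nu in \<open>simp add: norm_mult\<close>)
      ultimately have "((\<lambda>t. L (of_real t * u)) has_vector_derivative u * deriv L (of_real t * u)) (at t)"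
        using field_vector_diff_chain_at[of "\<lambda>t. of_real t * u" u t L] by (simp add: o_def)
      then show ?thesis
        unfolding \<phi>_def by (intro DERIV_diff has_field_derivative_Re has_field_derivative_exp_int)
    qed
    have "\<phi> 0 \<ge> \<phi> (norm z)"
    \<comment> \<open>The sign of the derivative is checked only for \<open>t > 0\<close>, where
      \<open>wdL\<close> can be divided by \<open>t\<close>; continuity covers the
      endpoints.\<close>
    proof (rule DERIV_nonpos_imp_decreasing_open[where f = \<phi>])
      show "continuous_on {0..norm z} \<phi>"
      proof (intro continuous_at_imp_continuous_on ballI)
        fix t assume "t \<in> {0..norm z}"
        then show "isCont \<phi> t" using DERIV_isCont[OF d[of t]] z by simp
      qed
    next
      fix t assume t: "0 < t" "t < norm z"
      let ?w = "of_real t * u"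
      have w: "norm ?w = t" "?w \<noteq> 0" using t nu by (auto simp: norm_mult)
      have "of_real t * (u * deriv L ?w) = exp (\<omega> ?w) - 1" using wdL[of ?w] w t z by (simp add: mult.assoc)
      then have "norm (of_real t * (u * deriv L ?w)) \<le> exp t - 1" using exp_\<omega>[of ?w] w t z by simp
      then have "norm (u * deriv L ?w) \<le> (exp t - 1) / t"
        using t by (simp add: norm_mult field_simps)
      then have "Re (u * deriv L ?w) \<le> (exp t - 1) / t"
        using complex_Re_le_cmod order_trans by blast
      then show "\<exists>y. DERIV \<phi> t :> y \<and> y \<le> 0" using d[of t] t z by (intro exI conjI) auto
    qed (use z in simp)
    then have "Re (L z) \<le> exp_int (norm z)" using L_0 by (simp add: \<phi>_def zu)
    then show ?thesis using fL[of z] z by (simp add: norm_mult mult_left_mono)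
  qed (simp add: f_0)
qed

section \<open>The radius equation and the numerical enclosure of its root\<close>

definition f0_gap :: "real \<Rightarrow> real" where
  "f0_gap r = (exp r - 1) * (r * exp (exp_int r))"

text \<open>Both factors are nonnegative and strictly increasing. Strictness makes the positive root
  unique and the estimate strict inside the radius.\<close>

lemma f0_gap_strict_mono:
  assumes "0 \<le> r" "r < s"
  shows "f0_gap r < f0_gap s"
  unfolding f0_gap_def
proof (rule mult_strict_mono)
  show "r * exp (exp_int r) < s * exp (exp_int s)"
    using assms exp_int_mono[of r s] by (intro mult_less_le_imp_less) auto
qed (use assms in auto)

lemma f0_gap_continuous: "continuous_on A f0_gap"
proof -
  have "continuous_on A (exp_int :: real \<Rightarrow> real)"
    by (intro continuous_at_imp_continuous_on ballI) (metis DERIV_isCont has_field_derivative_exp_int)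
  then show ?thesis unfolding f0_gap_def[abs_def] by (intro continuous_intros)
qed

lemma f0_gap_of_real:
  "2 * (exp (complex_of_real r) - 1) * f0 (complex_of_real r) - 1 = of_real (2 * f0_gap r - 1)"
  by (simp add: f0_gap_def f0_of_real exp_of_real)

text \<open>The point is 0.476813 - 0.0000005. Eleven Taylor terms plus remainder give upper bounds
  to nine decimals: \<open>?y\<close> for \<open>exp_int ?x\<close>, then one for
  \<open>exp ?y\<close>. Their product with \<open>?x\<close> stays below 1/2.\<close>

lemma f0_gap_lower: "f0_gap (4768125 / 10 ^ 7) < 1 / 2"
proof -
  let ?x = "4768125 / 10 ^ 7 :: real" and ?y = "540254833 / 10 ^ 9 :: real"
  have e1: "exp ?x - 1 \<le> 610931367 / 10 ^ 9"
    using exp_Taylor_bounds(2)[of ?x 11]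
    by (simp add: lessThan_nat_numeral fact_numeral power_divide)
  have "exp_int ?x \<le> ?y"
    using exp_int_Taylor_bounds(2)[of ?x 11]
    by (simp add: lessThan_nat_numeral fact_numeral power_divide)
  then have e2: "exp (exp_int ?x) \<le> exp ?y" by simp
  have e3: "exp ?y \<le> 1716444214 / 10 ^ 9"
    using exp_Taylor_bounds(2)[of ?y 11]
    by (simp add: lessThan_nat_numeral fact_numeral power_divide)
  have "f0_gap ?x \<le> 610931367 / 10 ^ 9 * (?x * (1716444214 / 10 ^ 9))"
    unfolding f0_gap_def by (intro mult_mono e1 order_trans[OF e2 e3]) auto
  then show ?thesis by simp
qed

text \<open>At 0.476813 + 0.0000005 the partial sums alone are lower bounds, since all terms are
  nonnegative; here \<open>?y\<close> lies below \<open>exp_int ?x\<close>.\<close>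

lemma f0_gap_upper: "1 / 2 < f0_gap (4768135 / 10 ^ 7)"
proof -
  let ?x = "4768135 / 10 ^ 7 :: real" and ?y = "540256113 / 10 ^ 9 :: real"
  have e1: "610932977 / 10 ^ 9 \<le> exp ?x - 1"
    using exp_Taylor_bounds(1)[of ?x 11]
    by (simp add: lessThan_nat_numeral fact_numeral power_divide)
  have "?y \<le> exp_int ?x"
    using exp_int_Taylor_bounds(1)[of ?x 11]
    by (simp add: lessThan_nat_numeral fact_numeral power_divide)
  then have e2: "exp ?y \<le> exp (exp_int ?x)" by simp
  have e3: "1716446410 / 10 ^ 9 \<le> exp ?y"
    using exp_Taylor_bounds(1)[of ?y 11]
    by (simp add: lessThan_nat_numeral fact_numeral power_divide)
  have "610932977 / 10 ^ 9 * (?x * (1716446410 / 10 ^ 9)) \<le> f0_gap ?x"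
    unfolding f0_gap_def by (intro mult_mono e1 order_trans[OF e3 e2]) auto
  then show ?thesis by simp
qed

theorem theorem2p13:
  shows "(\<exists>a :: nat \<Rightarrow> complex. (\<forall>z\<in>\<D>. (\<lambda>n. a n * z ^ n) sums f0 z) \<and>
           a 0 = 0 \<and> a 1 = 1 \<and> a 2 = 1 \<and> a 3 = 3 / 4 \<and> a 4 = 17 / 36 \<and> a 5 = 19 / 72) \<and>
         (\<exists>r0 :: real.
           smallest_positive_root (\<lambda>r. 2 * (exp (complex_of_real r) - 1) * f0 (complex_of_real r) - 1) r0 \<and>
           \<bar>r0 - 0.476813\<bar> < 0.0000005 \<and>
           (\<forall>f\<in>starlike_exp. f \<in> Omega_in_disc r0) \<and>
           (\<forall>r>r0. \<not> (\<forall>f\<in>starlike_exp. f \<in> Omega_in_disc r)))"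
proof -
  obtain r0 where r0: "4768125 / 10 ^ 7 \<le> r0" "r0 \<le> 4768135 / 10 ^ 7" and gap: "f0_gap r0 = 1 / 2"
    using IVT'[of f0_gap "4768125 / 10 ^ 7" "1 / 2" "4768135 / 10 ^ 7"]
      f0_gap_lower f0_gap_upper f0_gap_continuous by force
  \<comment> \<open>The intermediate value theorem gives a closed interval; the strict bounds at its
    ends exclude them, as the claimed accuracy is strict.\<close>
  have "r0 \<noteq> 4768125 / 10 ^ 7" using gap f0_gap_lower by (metis less_irrefl)
  moreover have "r0 \<noteq> 4768135 / 10 ^ 7" using gap f0_gap_upper by (metis less_irrefl)
  ultimately have close: "\<bar>r0 - 0.476813\<bar> < 0.0000005" using r0 by (simp add: abs_if)
  have pos: "0 < r0" and lt1: "r0 < 1" using r0 by simp_all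
  have "r0 \<le> s" if "0 < s" "2 * f0_gap s - 1 = 0" for s
    using f0_gap_strict_mono[of s r0] that gap by force
  then have root: "smallest_positive_root
      (\<lambda>r. 2 * (exp (complex_of_real r) - 1) * f0 (complex_of_real r) - 1) r0"
    unfolding smallest_positive_root_def f0_gap_of_real of_real_eq_0_iff using pos gap by simp
  have Omega: "f \<in> Omega_in_disc r0" if "f \<in> starlike_exp" for f
  proof -
    have "norm (z * deriv f z - f z) < 1 / 2" if z: "norm z < r0" for z
    proof -
      have "norm z < 1" using z lt1 by simp
      note growth = starlike_exp_growth[OF \<open>f \<in> starlike_exp\<close> this]
      have "norm (f z) * (exp (norm z) - 1) \<le> f0_gap (norm z)"
        using mult_right_mono[OF growth(1), of "exp (norm z) - 1"]
        by (simp add: f0_gap_def mult.commute)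
      then show ?thesis using growth(2) f0_gap_strict_mono[of "norm z" r0] z gap by simp
    qed
    then show ?thesis using that by (simp add: Omega_in_disc_def starlike_exp_def)
  qed
  \<comment> \<open>The witness is the point \<open>r0\<close> itself, which lies in every larger
    disc: there z f0'(z) - f0(z) equals \<open>f0_gap r0\<close>, exactly 1/2.\<close>
  have "f0 \<notin> Omega_in_disc r" if "r > r0" for r
  proof -
    have "complex_of_real r0 * deriv f0 (of_real r0) - f0 (of_real r0) = of_real (f0_gap r0)"
      by (simp add: deriv_f0 f0_eq f0_gap_def exp_int_of_real exp_of_real algebra_simps)
    then have "norm (complex_of_real r0 * deriv f0 (of_real r0) - f0 (of_real r0)) = 1 / 2"
      using gap by (simp only: norm_of_real)
    moreover have "norm (complex_of_real r0) < r" using that pos by simp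
    ultimately show ?thesis
      unfolding Omega_in_disc_def by (metis (mono_tags, lifting) less_irrefl mem_Collect_eq)
  qed
  then have "\<forall>r>r0. \<not> (\<forall>f\<in>starlike_exp. f \<in> Omega_in_disc r)"
    using f0_in_starlike_exp by blast
  with f0_power_series root close Omega show ?thesis by blast
qed

end
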